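(* Let $X$ be a Banach lattice and let $(S(t))_{t\ge0}$, $(S^+(t))_{t\ge0}$, $(S^-(t))_{t\ge0}$ be three semigroups of (not necessarily linear) operators on $X$. Assume that, for all $s,t\ge0$ and $x\in X$, - $S^-(t)x\le S(t)x\le S^+(t)x$, - $S(s)S^-(t)x\le S^-(t)S(s)x$ and $S^+(s)S(t)x\le S(t)S^+(s)x$. Furthermore, assume that for every $r,T\ge0$ there exists $c\ge0$ such that, for all $t\in[0,T]$ and $x,y\in B(0,r)$, $$\|S(t)x-S(t)y\|\le c\|x-y\|\quad\text{and}\quad\|S^\pm(t)x-S^\pm(t)y\|\le c\|x-y\|.$$ Then $\mathcal{L}^{S^+}\cap\mathcal{L}^{S^-}\subset\mathcal{L}^S$, and $S(t)$ maps $\mathcal{L}^{S^+}\cap\mathcal{L}^{S^-}$ into $\mathcal{L}^{S^+}\cap\mathcal{L}^{S^-}$ for all $t\ge0$.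
   Context: A semigroup on $X$ is a family $(S(t))_{t\ge0}$ of maps $S(t)\colon X\to X$ with $S(0)=\mathrm{id}_X$ and $S(s+t)=S(s)S(t)$ for all $s,t\ge0$. $B(0,r)$ is the closed ball of radius $r$ around $0$. For a family $(J(t))_{t\ge0}$ of maps $J(t)\colon X\to X$, the Lipschitz set $\mathcal{L}^J$ is the set of all $x\in X$ for which there exist $t_0>0$ and $c\ge0$ with $\|J(t)x-x\|\le ct$ for all $t\in[0,t_0]$. *)

theory Defs
  imports "HOL-Analysis.Analysis" "HOL-Library.Lattice_Algebras"
begin

text \<open>
  Real Banach lattices. The superclass \<open>lattice_ab_group_add_abs\<close> fixes the modulus
  to be \<open>\<bar>x\<bar> = sup x (- x)\<close>.
\<close>

class banach_lattice = banach + lattice_ab_group_add_abs + ordered_real_vector +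
  assumes norm_le_if_abs_le: "\<bar>x\<bar> \<le> \<bar>y\<bar> \<Longrightarrow> norm x \<le> norm y"

instance real :: banach_lattice
  by standard (auto simp: sup_real_def)

text \<open>
  Families indexed by \<open>t \<ge> 0\<close> are functions on \<^typ>\<open>real\<close> whose values at negative
  times are irrelevant. The operators need not be linear.
\<close>

definition operator_semigroup :: "(real \<Rightarrow> 'a \<Rightarrow> 'a) \<Rightarrow> bool" where
  "operator_semigroup S \<longleftrightarrow>
     S 0 = id \<and> (\<forall>s\<ge>0. \<forall>t\<ge>0. S (s + t) = S s \<circ> S t)"

definition lipschitz_set :: "(real \<Rightarrow> 'a \<Rightarrow> 'a) \<Rightarrow> 'a::real_normed_vector set" where
  "lipschitz_set J =
     {x. \<exists>t0>0. \<exists>c\<ge>0. \<forall>t\<in>{0..t0}. norm (J t x - x) \<le> c * t}"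

end

theory Submission
  imports Defs
begin

text \<open>
  The Lipschitz set of \<open>J\<close> consists of the points \<open>x\<close> whose increment \<open>J t x - x\<close> is \<open>O(t)\<close>
  as \<open>t\<close> decreases to \<open>0\<close>. In a Banach lattice an increment lying between two increments of
  order \<open>O(t)\<close> is itself of order \<open>O(t)\<close> (\<open>linearly_bounded_between\<close>), so the inclusion
  \<open>lipschitz_set Sp \<inter> lipschitz_set Sm \<subseteq> lipschitz_set S\<close> follows from \<open>Sm t x \<le> S t x \<le> Sp t x\<close>.

  For the invariance let \<open>y = S s x\<close>. The commutation inequalities bound the increments of \<open>Sp\<close> and
  \<open>Sm\<close> at \<open>y\<close> on one side, and comparison with \<open>S\<close>, whose operators commute with each other,
  bounds them on the other:
  \<open>S s (S t x) = S t y \<le> Sp t y \<le> S s (Sp t x)\<close> and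
  \<open>S s (Sm t x) \<le> Sm t y \<le> S t y = S s (S t x)\<close>.
  All four outer terms have the form \<open>S s (J t x)\<close> where \<open>x\<close> lies in the Lipschitz set of \<open>J\<close>.
  For small \<open>t\<close> the points \<open>J t x\<close> stay in a fixed ball, on which \<open>S s\<close> is Lipschitz, so
  \<open>S s (J t x) - S s x\<close> is \<open>O(t)\<close> (\<open>linearly_bounded_image\<close>), and the sandwich applies again.
\<close>

definition linearly_bounded :: "(real \<Rightarrow> 'a::real_normed_vector) \<Rightarrow> bool" where
  "linearly_bounded f \<longleftrightarrow> (\<exists>t0>0. \<exists>c\<ge>0. \<forall>t\<in>{0..t0}. norm (f t) \<le> c * t)"

lemma linearly_boundedI:
  assumes "t0 > 0" and "c \<ge> 0" and "\<And>t. t \<in> {0..t0} \<Longrightarrow> norm (f t) \<le> c * t"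
  shows "linearly_bounded f"
  unfolding linearly_bounded_def
  by (rule exI[of _ t0], intro conjI exI[of _ c] ballI assms)

lemma lipschitz_set_iff_linearly_bounded:
  "x \<in> lipschitz_set J \<longleftrightarrow> linearly_bounded (\<lambda>t. J t x - x)"
  by (simp add: lipschitz_set_def linearly_bounded_def)

lemma norm_abs_banach_lattice: "norm \<bar>x\<bar> = norm (x::'a::banach_lattice)"
  by (intro antisym norm_le_if_abs_le) simp_all

text \<open>
  The order bounds give \<open>\<bar>b\<bar> \<le> \<bar>a\<bar> + \<bar>c\<bar>\<close>, to which monotonicity of the norm and the
  triangle inequality apply.
\<close>

lemma norm_between_le:
  fixes a b c :: "'a::banach_lattice"
  assumes "a \<le> b" and "b \<le> c"
  shows "norm b \<le> norm a + norm c"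
proof -
  have "b \<le> \<bar>a\<bar> + \<bar>c\<bar>"
    using add_increasing[OF abs_ge_zero order_trans[OF assms(2) abs_ge_self]] .
  moreover have "- b \<le> \<bar>a\<bar> + \<bar>c\<bar>"
    using assms(1) by (intro add_increasing2 abs_ge_zero order_trans[OF _ abs_ge_minus_self]) simp
  ultimately have "\<bar>b\<bar> \<le> \<bar>\<bar>a\<bar> + \<bar>c\<bar>\<bar>"
    by (simp add: abs_leI)
  then have "norm b \<le> norm (\<bar>a\<bar> + \<bar>c\<bar>)"
    by (rule norm_le_if_abs_le)
  also have "\<dots> \<le> norm a + norm c"
    using norm_triangle_ineq[of "\<bar>a\<bar>" "\<bar>c\<bar>"] by (simp add: norm_abs_banach_lattice)
  finally show ?thesis .
qed

lemma linearly_bounded_between: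
  fixes f g h :: "real \<Rightarrow> 'a::banach_lattice"
  assumes "linearly_bounded f" and "linearly_bounded h"
    and between: "\<And>t. t \<ge> 0 \<Longrightarrow> f t \<le> g t \<and> g t \<le> h t"
  shows "linearly_bounded g"
proof -
  obtain t1 c1 where 1: "t1 > 0" "c1 \<ge> 0" "\<And>t. t \<in> {0..t1} \<Longrightarrow> norm (f t) \<le> c1 * t"
    using assms(1) unfolding linearly_bounded_def by blast
  obtain t2 c2 where 2: "t2 > 0" "c2 \<ge> 0" "\<And>t. t \<in> {0..t2} \<Longrightarrow> norm (h t) \<le> c2 * t"
    using assms(2) unfolding linearly_bounded_def by blast
  have "norm (g t) \<le> (c1 + c2) * t" if "t \<in> {0..min t1 t2}" for t
  proof -
    have "norm (g t) \<le> norm (f t) + norm (h t)"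
      using between that by (intro norm_between_le) auto
    also have "\<dots> \<le> c1 * t + c2 * t"
      using 1(3) 2(3) that by (intro add_mono) auto
    finally show ?thesis by (simp add: distrib_right)
  qed
  moreover have "min t1 t2 > 0" and "c1 + c2 \<ge> 0"
    using 1 2 by auto
  ultimately show ?thesis
    by (intro linearly_boundedI)
qed

text \<open>
  A linearly bounded increment keeps \<open>J t x\<close> in the fixed ball of radius \<open>norm x + c * t0\<close>
  for all \<open>t \<in> {0..t0}\<close>, so a single Lipschitz constant of \<open>F\<close> suffices.
\<close>

lemma linearly_bounded_image:
  fixes F :: "'a::real_normed_vector \<Rightarrow> 'b::real_normed_vector"
  assumes "x \<in> lipschitz_set J"
    and F: "\<And>r. r \<ge> 0 \<Longrightarrow>
      \<exists>L\<ge>0. \<forall>u\<in>cball 0 r. \<forall>v\<in>cball 0 r. norm (F u - F v) \<le> L * norm (u - v)"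
  shows "linearly_bounded (\<lambda>t. F (J t x) - F x)"
proof -
  obtain t0 c where J: "t0 > 0" "c \<ge> 0" "\<And>t. t \<in> {0..t0} \<Longrightarrow> norm (J t x - x) \<le> c * t"
    using assms(1) unfolding lipschitz_set_def by blast
  define r where "r = norm x + c * t0"
  have "c * t0 \<ge> 0" using J by simp
  then have "r \<ge> 0" and x_in: "x \<in> cball 0 r" unfolding r_def by auto
  from F[OF this(1)] obtain L where L: "L \<ge> 0"
      "\<And>u v. u \<in> cball 0 r \<Longrightarrow> v \<in> cball 0 r \<Longrightarrow> norm (F u - F v) \<le> L * norm (u - v)"
    by blast
  have "norm (F (J t x) - F x) \<le> (L * c) * t" if t: "t \<in> {0..t0}" for t
  proof -
    have "norm (J t x) \<le> norm x + norm (J t x - x)"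
      by (rule norm_triangle_sub)
    also have "\<dots> \<le> norm x + c * t"
      using J(3)[OF t] by simp
    also have "\<dots> \<le> r"
      using t J(2) unfolding r_def by (simp add: mult_left_mono)
    finally have "J t x \<in> cball 0 r" by simp
    then have "norm (F (J t x) - F x) \<le> L * norm (J t x - x)"
      using x_in by (rule L(2))
    also have "\<dots> \<le> L * (c * t)"
      using J(3)[OF t] L(1) by (rule mult_left_mono)
    finally show ?thesis by (simp add: mult.assoc)
  qed
  moreover have "L * c \<ge> 0" using L(1) J(2) by simp
  ultimately show ?thesis
    using J(1) by (intro linearly_boundedI)
qed

theorem theorem5p1:
  fixes S Sp Sm :: "real \<Rightarrow> 'a::banach_lattice \<Rightarrow> 'a"
  assumes "operator_semigroup S" and "operator_semigroup Sp" and "operator_semigroup Sm"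
    and "\<And>t x. t \<ge> 0 \<Longrightarrow> Sm t x \<le> S t x \<and> S t x \<le> Sp t x"
    and "\<And>s t x. s \<ge> 0 \<Longrightarrow> t \<ge> 0 \<Longrightarrow>
           S s (Sm t x) \<le> Sm t (S s x) \<and> Sp s (S t x) \<le> S t (Sp s x)"
    and "\<And>r T. r \<ge> 0 \<Longrightarrow> T \<ge> 0 \<Longrightarrow>
           \<exists>c\<ge>0. \<forall>t\<in>{0..T}. \<forall>x\<in>cball 0 r. \<forall>y\<in>cball 0 r.
             norm (S t x - S t y) \<le> c * norm (x - y) \<and>
             norm (Sp t x - Sp t y) \<le> c * norm (x - y) \<and>
             norm (Sm t x - Sm t y) \<le> c * norm (x - y)"
  shows "lipschitz_set Sp \<inter> lipschitz_set Sm \<subseteq> lipschitz_set S \<and>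
         (\<forall>t\<ge>0. S t ` (lipschitz_set Sp \<inter> lipschitz_set Sm)
                  \<subseteq> lipschitz_set Sp \<inter> lipschitz_set Sm)"
proof (intro conjI allI impI)
  show incl: "lipschitz_set Sp \<inter> lipschitz_set Sm \<subseteq> lipschitz_set S"
  proof
    fix x assume "x \<in> lipschitz_set Sp \<inter> lipschitz_set Sm"
    then have "linearly_bounded (\<lambda>t. Sm t x - x)" and "linearly_bounded (\<lambda>t. Sp t x - x)"
      by (simp_all add: lipschitz_set_iff_linearly_bounded)
    then show "x \<in> lipschitz_set S"
      unfolding lipschitz_set_iff_linearly_bounded
      by (rule linearly_bounded_between) (simp add: assms(4) diff_right_mono)
  qed
  fix s :: real assume s: "s \<ge> 0"
  show "S s ` (lipschitz_set Sp \<inter> lipschitz_set Sm) \<subseteq> lipschitz_set Sp \<inter> lipschitz_set Sm"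
  proof (rule image_subsetI)
    fix x assume x: "x \<in> lipschitz_set Sp \<inter> lipschitz_set Sm"
    have commute: "S t (S s x) = S s (S t x)" if "t \<ge> 0" for t
    proof -
      have "S (t + s) = S t \<circ> S s" and "S (s + t) = S s \<circ> S t"
        using assms(1) s that unfolding operator_semigroup_def by blast+
      then show ?thesis by (simp add: add.commute fun_eq_iff)
    qed
    have lipschitz: "\<exists>L\<ge>0. \<forall>u\<in>cball 0 r. \<forall>v\<in>cball 0 r. norm (S s u - S s v) \<le> L * norm (u - v)"
      if r: "r \<ge> 0" for r
    proof -
      obtain L where "L \<ge> 0" and L: "\<forall>t\<in>{0..s}. \<forall>u\<in>cball 0 r. \<forall>v\<in>cball 0 r.
          norm (S t u - S t v) \<le> L * norm (u - v) \<and>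
          norm (Sp t u - Sp t v) \<le> L * norm (u - v) \<and>
          norm (Sm t u - Sm t v) \<le> L * norm (u - v)"
        using assms(6)[OF r s] by blast
      have "s \<in> {0..s}" using s by simp
      from bspec[OF L this] have "\<forall>u\<in>cball 0 r. \<forall>v\<in>cball 0 r.
          norm (S s u - S s v) \<le> L * norm (u - v)" by simp
      with \<open>L \<ge> 0\<close> show ?thesis by (intro exI[of _ L] conjI)
    qed
    have image: "linearly_bounded (\<lambda>t. S s (J t x) - S s x)" if "x \<in> lipschitz_set J" for J
      using that lipschitz by (rule linearly_bounded_image)
    have "S s x \<in> lipschitz_set Sp"
      unfolding lipschitz_set_iff_linearly_bounded
    proof (rule linearly_bounded_between[OF image[of S] image[of Sp]])
      show "S s (S t x) - S s x \<le> Sp t (S s x) - S s x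
          \<and> Sp t (S s x) - S s x \<le> S s (Sp t x) - S s x" if "t \<ge> 0" for t
        using assms(4)[of t "S s x"] assms(5)[of t s x] commute s that
        by (simp add: diff_right_mono)
    qed (use x incl in auto)
    moreover have "S s x \<in> lipschitz_set Sm"
      unfolding lipschitz_set_iff_linearly_bounded
    proof (rule linearly_bounded_between[OF image[of Sm] image[of S]])
      show "S s (Sm t x) - S s x \<le> Sm t (S s x) - S s x
          \<and> Sm t (S s x) - S s x \<le> S s (S t x) - S s x" if "t \<ge> 0" for t
        using assms(4)[of t "S s x"] assms(5)[of s t x] commute s that
        by (simp add: diff_right_mono)
    qed (use x incl in auto)
    ultimately show "S s x \<in> lipschitz_set Sp \<inter> lipschitz_set Sm" by simp
  qed
qed

end
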